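(* The construction $Y(G)$ is part of a covariant functor $Y$ from the category $\mathfrak{C}$ of finite groups and homomorphisms injective on commutators to the category $\mathfrak{D}$ of finite oriented $2$-dimensional simplicial complexes and orientation preserving simplicial maps.
   Context: For a finite group $G$ with center $Z(G)$, $X(G)$ is the simplicial complex with vertex set $\{(x,1): x\in G-Z(G)\}\sqcup\{(x,2): x\in G-Z(G)\}$, whose edges are $[(x,1),(y,1)]$ and $[(x,1),(y,2)]$ for all $x,y$ with $xy\ne yx$, and whose $2$-faces are $[(x,1),(y,1),(xy,2)]$ for all ordered pairs $(x,y)$ with $xy\neq yx$, each oriented by the vertex order indicated (it is empty if $G$ is abelian; the empty complex is admitted as an object of $\mathfrak D$). The link of every vertex of $X(G)$ is a disjoint union of finitely many triangulated circles. The desingularization $Y(G)$ is obtained from $X(G)$ by removing all vertices and filling in distinct punctures by distinct points; there is one puncture for each pair $(v,c)$ with $v$ a vertex of $X(G)$ and $c$ a circle (connected component) of the link of $v$. As an oriented simplicial complex, $Y(G)$ has these pairs $(v,c)$ as vertices and has the same oriented triangles as $X(G)$, where a triangle $\sigma$ of $X(G)$ containing $v$ has in $Y(G)$ the vertex $(v,c)$ with $c$ the circle containing the edge of $\sigma$ opposite $v$. A group homomorphism $f:G\to H$ is injective on commutators if its restriction to the commutator subgroup $G'$ is injective. A simplicial map between oriented $2$-dimensional complexes is orientation preserving if it takes $2$-simplices to $2$-simplices and preserves the orientation of the individual $2$-simplices. The simplicial map $X(f):X(G)\to X(H)$ is given on vertices by $(v,i)\mapsto(f(v),i)$, and $Y(f)$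 sends the vertex of $Y(G)$ associated with a circle in the link of $(v,i)$ to the vertex of $Y(H)$ associated with the circle in the link of $(f(v),i)$ into which $X(f)$ takes the first circle. *)

theory Defs
  imports "HOL-Algebra.Generated_Groups"
begin

section \<open>Categories and covariant functors\<close>

text \<open>Hom-sets are indexed by source and target and need not be disjoint;
  \<open>Comp C A B D g f\<close> is the composite of \<open>f\<close> from \<open>A\<close> to \<open>B\<close> and \<open>g\<close> from \<open>B\<close> to \<open>D\<close>.\<close>

record ('o, 'm) category_data =
  Obj :: "'o set"
  Mor :: "'o \<Rightarrow> 'o \<Rightarrow> 'm set"
  Ident :: "'o \<Rightarrow> 'm"
  Comp :: "'o \<Rightarrow> 'o \<Rightarrow> 'o \<Rightarrow> 'm \<Rightarrow> 'm \<Rightarrow> 'm"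

locale is_category =
  fixes C :: "('o, 'm) category_data"
  assumes Ident_in_Mor: "A \<in> Obj C \<Longrightarrow> Ident C A \<in> Mor C A A"
    and Comp_in_Mor:
      "\<lbrakk>A \<in> Obj C; B \<in> Obj C; D \<in> Obj C; f \<in> Mor C A B; g \<in> Mor C B D\<rbrakk>
        \<Longrightarrow> Comp C A B D g f \<in> Mor C A D"
    and Comp_Ident_right:
      "\<lbrakk>A \<in> Obj C; B \<in> Obj C; f \<in> Mor C A B\<rbrakk> \<Longrightarrow> Comp C A A B f (Ident C A) = f"
    and Comp_Ident_left:
      "\<lbrakk>A \<in> Obj C; B \<in> Obj C; f \<in> Mor C A B\<rbrakk> \<Longrightarrow> Comp C A B B (Ident C B) f = f"
    and Comp_assoc:
      "\<lbrakk>A \<in> Obj C; B \<in> Obj C; D \<in> Obj C; E \<in> Obj C;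
        f \<in> Mor C A B; g \<in> Mor C B D; h \<in> Mor C D E\<rbrakk>
        \<Longrightarrow> Comp C A D E h (Comp C A B D g f) = Comp C A B E (Comp C B D E h g) f"

locale covariant_functor = source: is_category C + target: is_category D
  for C :: "('o, 'm) category_data" and D :: "('p, 'n) category_data" +
  fixes F_obj :: "'o \<Rightarrow> 'p"
    and F_mor :: "'o \<Rightarrow> 'o \<Rightarrow> 'm \<Rightarrow> 'n"
  assumes F_obj_in_Obj: "A \<in> Obj C \<Longrightarrow> F_obj A \<in> Obj D"
    and F_mor_in_Mor:
      "\<lbrakk>A \<in> Obj C; B \<in> Obj C; f \<in> Mor C A B\<rbrakk> \<Longrightarrow> F_mor A B f \<in> Mor D (F_obj A) (F_obj B)"
    and F_mor_Ident: "A \<in> Obj C \<Longrightarrow> F_mor A A (Ident C A) = Ident D (F_obj A)"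
    and F_mor_Comp:
      "\<lbrakk>A \<in> Obj C; B \<in> Obj C; E \<in> Obj C; f \<in> Mor C A B; g \<in> Mor C B E\<rbrakk>
        \<Longrightarrow> F_mor A E (Comp C A B E g f)
          = Comp D (F_obj A) (F_obj B) (F_obj E) (F_mor B E g) (F_mor A B f)"


section \<open>Finite groups and homomorphisms injective on commutators\<close>

definition injective_on_commutators ::
    "('a, 'c) monoid_scheme \<Rightarrow> ('b, 'd) monoid_scheme \<Rightarrow> ('a \<Rightarrow> 'b) \<Rightarrow> bool" where
  "injective_on_commutators G H f \<longleftrightarrow> f \<in> hom G H \<and> inj_on f (derived G (carrier G))"

text \<open>A morphism is a function on the carrier, so it is taken to be \<^const>\<open>undefined\<close> elsewhere;
  likewise for simplicial maps below. The carriers are subsets of an arbitrary type \<open>'a\<close>.\<close>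

definition category_C :: "('a monoid, 'a \<Rightarrow> 'a) category_data" where
  "category_C = \<lparr>
     Obj = {G. group G \<and> finite (carrier G)},
     Mor = (\<lambda>G H. {f \<in> extensional (carrier G). injective_on_commutators G H f}),
     Ident = (\<lambda>G. \<lambda>x\<in>carrier G. x),
     Comp = (\<lambda>G H K g f. compose (carrier G) g f)\<rparr>"


section \<open>Oriented 2-dimensional simplicial complexes\<close>

text \<open>Simplices are given by their vertex sets. An orientation of a 2-simplex is a class of
  orderings of its vertices modulo even (cyclic) permutations; \<open>positive\<close> collects all orderings
  belonging to the chosen orientations.\<close>

record 'v oriented_complex =
  simplices :: "'v set set"
  positive :: "('v \<times> 'v \<times> 'v) set"

definition vertices :: "'v oriented_complex \<Rightarrow> 'v set" where
  "vertices K = \<Union>(simplices K)"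

definition two_simplices :: "'v oriented_complex \<Rightarrow> 'v set set" where
  "two_simplices K = {\<sigma> \<in> simplices K. card \<sigma> = 3}"

definition finite_simplicial_complex :: "'v set set \<Rightarrow> bool" where
  "finite_simplicial_complex S \<longleftrightarrow>
     finite S \<and> (\<forall>\<sigma>\<in>S. finite \<sigma> \<and> \<sigma> \<noteq> {} \<and> (\<forall>\<tau>. \<tau> \<subseteq> \<sigma> \<and> \<tau> \<noteq> {} \<longrightarrow> \<tau> \<in> S))"

text \<open>The empty complex counts as 2-dimensional.\<close>

definition two_dimensional :: "'v set set \<Rightarrow> bool" where
  "two_dimensional S \<longleftrightarrow> (\<forall>\<sigma>\<in>S. card \<sigma> \<le> 3) \<and> (S \<noteq> {} \<longrightarrow> (\<exists>\<sigma>\<in>S. card \<sigma> = 3))"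

text \<open>Of the two classes of orderings of each 2-simplex exactly one is selected.\<close>

definition orients_two_simplices :: "'v oriented_complex \<Rightarrow> bool" where
  "orients_two_simplices K \<longleftrightarrow>
     (\<forall>(a, b, c)\<in>positive K. {a, b, c} \<in> two_simplices K \<and> (b, c, a) \<in> positive K) \<and>
     (\<forall>a b c. {a, b, c} \<in> two_simplices K \<longrightarrow>
        ((a, b, c) \<in> positive K \<longleftrightarrow> (b, a, c) \<notin> positive K))"

definition finite_oriented_2_complex :: "'v oriented_complex \<Rightarrow> bool" where
  "finite_oriented_2_complex K \<longleftrightarrow>
     finite_simplicial_complex (simplices K) \<and> two_dimensional (simplices K) \<and>
     orients_two_simplices K"

definition simplicial_map :: "'v oriented_complex \<Rightarrow> 'w oriented_complex \<Rightarrow> ('v \<Rightarrow> 'w) \<Rightarrow> bool" where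
  "simplicial_map K L f \<longleftrightarrow> (\<forall>\<sigma>\<in>simplices K. f ` \<sigma> \<in> simplices L)"

definition orientation_preserving ::
    "'v oriented_complex \<Rightarrow> 'w oriented_complex \<Rightarrow> ('v \<Rightarrow> 'w) \<Rightarrow> bool" where
  "orientation_preserving K L f \<longleftrightarrow>
     (\<forall>\<sigma>\<in>two_simplices K. f ` \<sigma> \<in> two_simplices L) \<and>
     (\<forall>(a, b, c)\<in>positive K. (f a, f b, f c) \<in> positive L)"

definition category_D :: "('v oriented_complex, 'v \<Rightarrow> 'v) category_data" where
  "category_D = \<lparr>
     Obj = {K. finite_oriented_2_complex K},
     Mor = (\<lambda>K L. {f \<in> extensional (vertices K).
                      simplicial_map K L f \<and> orientation_preserving K L f}),
     Ident = (\<lambda>K. \<lambda>v\<in>vertices K. v),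
     Comp = (\<lambda>K L M g f. compose (vertices K) g f)\<rparr>"


section \<open>The complex \<open>X(G)\<close>\<close>

definition center :: "('a, 'c) monoid_scheme \<Rightarrow> 'a set" where
  "center G = {z \<in> carrier G. \<forall>x\<in>carrier G. z \<otimes>\<^bsub>G\<^esub> x = x \<otimes>\<^bsub>G\<^esub> z}"

definition noncommuting :: "('a, 'c) monoid_scheme \<Rightarrow> ('a \<times> 'a) set" where
  "noncommuting G =
     {(x, y). x \<in> carrier G \<and> y \<in> carrier G \<and> x \<otimes>\<^bsub>G\<^esub> y \<noteq> y \<otimes>\<^bsub>G\<^esub> x}"

definition complex_X :: "('a, 'c) monoid_scheme \<Rightarrow> ('a \<times> nat) oriented_complex" where
  "complex_X G = \<lparr>
     simplices =
       {{(x, i)} | x i. x \<in> carrier G - center G \<and> i \<in> {1, 2}} \<union>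
       {{(x, 1), (y, 1)} | x y. (x, y) \<in> noncommuting G} \<union>
       {{(x, 1), (y, 2)} | x y. (x, y) \<in> noncommuting G} \<union>
       {{(x, 1), (y, 1), (x \<otimes>\<^bsub>G\<^esub> y, 2)} | x y. (x, y) \<in> noncommuting G},
     positive =
       (\<Union>(x, y)\<in>noncommuting G.
          {((x, 1), (y, 1), (x \<otimes>\<^bsub>G\<^esub> y, 2)),
           ((y, 1), (x \<otimes>\<^bsub>G\<^esub> y, 2), (x, 1)),
           ((x \<otimes>\<^bsub>G\<^esub> y, 2), (x, 1), (y, 1))})\<rparr>"

definition map_X ::
    "('a, 'c) monoid_scheme \<Rightarrow> ('a \<Rightarrow> 'b) \<Rightarrow> 'a \<times> nat \<Rightarrow> 'b \<times> nat" where
  "map_X G f = (\<lambda>(x, i)\<in>vertices (complex_X G). (f x, i))"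


section \<open>The desingularization \<open>Y(G)\<close>\<close>

definition link :: "'v oriented_complex \<Rightarrow> 'v \<Rightarrow> 'v set set" where
  "link K v = {\<tau> \<in> simplices K. v \<notin> \<tau> \<and> insert v \<tau> \<in> simplices K}"

text \<open>Connected components of a complex are taken as subcomplexes (sets of simplices): two simplices
  lie in the same component iff they are joined by a chain of pairwise intersecting simplices.\<close>

definition component_of :: "'v set set \<Rightarrow> 'v set \<Rightarrow> 'v set set" where
  "component_of S \<tau> = {(\<alpha>, \<beta>). \<alpha> \<in> S \<and> \<beta> \<in> S \<and> \<alpha> \<inter> \<beta> \<noteq> {}}\<^sup>+ `` {\<tau>}"

definition components_of :: "'v set set \<Rightarrow> 'v set set set" where
  "components_of S = component_of S ` S"

text \<open>A puncture is a pair \<open>(v, c)\<close> of a vertex and a component of its link. The vertex \<open>v\<close> of a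
  2-simplex \<open>\<sigma>\<close> is replaced by the puncture whose component contains the opposite edge \<open>\<sigma> - {v}\<close>.\<close>

definition punctures :: "'v oriented_complex \<Rightarrow> ('v \<times> 'v set set) set" where
  "punctures K = (SIGMA v:vertices K. components_of (link K v))"

definition puncture_at :: "'v oriented_complex \<Rightarrow> 'v set \<Rightarrow> 'v \<Rightarrow> 'v \<times> 'v set set" where
  "puncture_at K \<sigma> v = (v, component_of (link K v) (\<sigma> - {v}))"

definition desingularization ::
    "'v oriented_complex \<Rightarrow> ('v \<times> 'v set set) oriented_complex" where
  "desingularization K = \<lparr>
     simplices =
       {{p} | p. p \<in> punctures K} \<union>
       {\<tau>. \<tau> \<noteq> {} \<and> (\<exists>\<sigma>\<in>two_simplices K. \<tau> \<subseteq> puncture_at K \<sigma> ` \<sigma>)},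
     positive =
       {(puncture_at K {a, b, c} a, puncture_at K {a, b, c} b, puncture_at K {a, b, c} c) | a b c.
          (a, b, c) \<in> positive K}\<rparr>"

type_synonym 'a Y_vertex = "('a \<times> nat) \<times> ('a \<times> nat) set set"

definition complex_Y :: "('a, 'c) monoid_scheme \<Rightarrow> 'a Y_vertex oriented_complex" where
  "complex_Y G = desingularization (complex_X G)"

text \<open>\<open>(`) (map_X G f) ` c\<close> is the image of the subcomplex \<open>c\<close> under the simplicial map \<open>X(f)\<close>.\<close>

definition map_Y ::
    "('a, 'c) monoid_scheme \<Rightarrow> ('b, 'd) monoid_scheme \<Rightarrow> ('a \<Rightarrow> 'b) \<Rightarrow> 'a Y_vertex \<Rightarrow> 'b Y_vertex" where
  "map_Y G H f = (\<lambda>(v, c)\<in>vertices (complex_Y G).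
     (map_X G f v,
      THE d. d \<in> components_of (link (complex_X H) (map_X G f v)) \<and>
             (`) (map_X G f) ` c \<subseteq> d))"

end

theory Submission
  imports Defs
begin

text \<open>A homomorphism injective on commutators preserves and reflects commutation, so \<open>X(f)\<close> is
  injective on every simplex. A simplicial map with this property takes the link of \<open>v\<close> into the
  link of the image of \<open>v\<close>, hence each component into exactly one component; and it takes the
  component of the edge of \<open>\<sigma>\<close> opposite \<open>v\<close> to the component of the edge of the image of \<open>\<sigma>\<close>
  opposite the image of \<open>v\<close>. Functoriality of \<open>Y\<close> follows from this formula.\<close>

section \<open>Homomorphisms injective on commutators\<close>

text \<open>Commutation is reflected because the commutator of x and y lies in the derived subgroup
  together with the identity, so its image is trivial only if it is trivial itself. Noncommutation
  also makes X(G) an oriented complex: the pairs (x,y) and (y,x) would orient one vertex set in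
  opposite ways exactly when xy = yx, and such pairs span no triangle; and if x and y do not
  commute, neither commutes with xy, which supplies the remaining edges of the triangle. The map on
  punctures is a definite description, which says nothing until existence and uniqueness of the
  target component are known. The way out is to name a component by any one of its simplices: the
  description then has a closed form, and the functor laws become equations between images of a
  single link simplex. Everything about punctures is therefore proved for finite complexes and
  simplexwise injective maps, and groups enter only through X.\<close>

lemma noncommuting_image:
  assumes "group G" "group H" "injective_on_commutators G H f" "(x, y) \<in> noncommuting G"
  shows "(f x, f y) \<in> noncommuting H"
proof -
  interpret group_hom G H f
    using assms by (simp add: group_hom_def group_hom_axioms_def injective_on_commutators_def)
  let ?k = "x \<otimes>\<^bsub>G\<^esub> y \<otimes>\<^bsub>G\<^esub> inv\<^bsub>G\<^esub> x \<otimes>\<^bsub>G\<^esub> inv\<^bsub>G\<^esub> y"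
  have x: "x \<in> carrier G" and y: "y \<in> carrier G" and ne: "x \<otimes>\<^bsub>G\<^esub> y \<noteq> y \<otimes>\<^bsub>G\<^esub> x"
    using assms(4) by (auto simp: noncommuting_def)
  have inj: "inj_on f (derived G (carrier G))"
    using assms(3) by (simp add: injective_on_commutators_def)
  \<comment> \<open>Both elements must lie where \<open>f\<close> is injective, so that
    \<open>f ?k = f \<one>\<close> forces \<open>?k\<close> to be trivial.\<close>
  have k: "?k \<in> derived G (carrier G)" "\<one>\<^bsub>G\<^esub> \<in> derived G (carrier G)"
    unfolding derived_def using x y by (auto intro!: generate.incl generate.one)
  have "f x \<otimes>\<^bsub>H\<^esub> f y \<noteq> f y \<otimes>\<^bsub>H\<^esub> f x"
  proof
    assume c: "f x \<otimes>\<^bsub>H\<^esub> f y = f y \<otimes>\<^bsub>H\<^esub> f x"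
    have "f ?k = f x \<otimes>\<^bsub>H\<^esub> f y \<otimes>\<^bsub>H\<^esub> inv\<^bsub>H\<^esub> f x \<otimes>\<^bsub>H\<^esub> inv\<^bsub>H\<^esub> f y"
      using x y by simp
    also have "\<dots> = \<one>\<^bsub>H\<^esub>"
      using x y by (simp add: c H.m_assoc)
    finally have "?k = \<one>\<^bsub>G\<^esub>"
      using inj_onD[OF inj _ k] by simp
    \<comment> \<open>Multiplying the commutator by yx telescopes to xy, so a trivial commutator
      would give xy = yx.\<close>
    then have "?k \<otimes>\<^bsub>G\<^esub> (y \<otimes>\<^bsub>G\<^esub> x) = y \<otimes>\<^bsub>G\<^esub> x"
      using x y by simp
    moreover have "?k \<otimes>\<^bsub>G\<^esub> (y \<otimes>\<^bsub>G\<^esub> x) = x \<otimes>\<^bsub>G\<^esub> y"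
    proof -
      have "inv\<^bsub>G\<^esub> y \<otimes>\<^bsub>G\<^esub> (y \<otimes>\<^bsub>G\<^esub> x) = x"
        using x y by (simp add: G.m_assoc[symmetric])
      then show ?thesis using x y by (simp add: G.m_assoc)
    qed
    ultimately show False using ne by simp
  qed
  then show ?thesis using x y by (simp add: noncommuting_def)
qed

text \<open>Injectivity of \<open>g\<close> helps only if \<open>f\<close> carries the derived
  subgroup of \<open>G\<close> into that of \<open>H\<close>. It does, since a homomorphism maps
  derived subgroups onto derived subgroups of images, and these grow with the group.\<close>

lemma injective_on_commutators_compose:
  assumes "group G" "group H"
    and "injective_on_commutators G H f" "injective_on_commutators H K g"
  shows "injective_on_commutators G K (compose (carrier G) g f)"
proof -
  interpret group_hom G H f
    using assms by (simp add: group_hom_def group_hom_axioms_def injective_on_commutators_def)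
  have sub: "derived G (carrier G) \<subseteq> carrier G"
    by (simp add: G.derived_in_carrier)
  have "f ` derived G (carrier G) = derived H (f ` carrier G)"
    by (simp add: derived_img)
  also have "\<dots> \<subseteq> derived H (carrier H)"
    by (intro H.mono_derived) auto
  finally have "inj_on g (f ` derived G (carrier G))"
    using assms(4) by (metis injective_on_commutators_def inj_on_subset)
  then have "inj_on (g \<circ> f) (derived G (carrier G))"
    using assms(3) by (simp add: injective_on_commutators_def comp_inj_on)
  then have "inj_on (compose (carrier G) g f) (derived G (carrier G))"
    using sub by (simp add: inj_on_def compose_def subset_iff)
  moreover have "compose (carrier G) g f \<in> hom G K"
    using assms by (intro G.hom_compose) (auto simp: injective_on_commutators_def)
  ultimately show ?thesis by (simp add: injective_on_commutators_def)
qed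

lemma injective_on_commutators_funcset:
  "injective_on_commutators G H f \<Longrightarrow> f \<in> carrier G \<rightarrow> carrier H"
  by (simp add: injective_on_commutators_def hom_def)

lemma is_category_C: "is_category category_C"
proof
  fix A :: "'a monoid" assume "A \<in> Obj category_C"
  then interpret group A by (simp add: category_C_def)
  have "(\<lambda>x\<in>carrier A. x) \<in> hom A A" by (auto simp: hom_def)
  moreover have "inj_on (\<lambda>x\<in>carrier A. x) (derived A (carrier A))"
    using derived_in_carrier[of "carrier A"] by (auto simp: inj_on_def subset_iff)
  ultimately show "Ident category_C A \<in> Mor category_C A A"
    by (auto simp: category_C_def injective_on_commutators_def)
next
  fix A B D E :: "'a monoid" and f g h
  assume "f \<in> Mor category_C A B"
  \<comment> \<open>The inner composite of \<open>g\<close> and \<open>h\<close> is restricted to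
    \<open>carrier B\<close>, so associativity requires that \<open>f\<close> land there.\<close>
  then have "f \<in> carrier A \<rightarrow> carrier B"
    by (simp add: category_C_def injective_on_commutators_funcset)
  then show "Comp category_C A D E h (Comp category_C A B D g f) =
      Comp category_C A B E (Comp category_C B D E h g) f"
    by (simp add: category_C_def compose_assoc)
qed (auto simp: category_C_def intro: injective_on_commutators_compose
      compose_Id[OF injective_on_commutators_funcset]
      Id_compose[OF injective_on_commutators_funcset])


section \<open>Simplicial complexes\<close>

lemma finite_simplicial_complexD:
  assumes "finite_simplicial_complex S" "\<sigma> \<in> S"
  shows "finite \<sigma>" "\<sigma> \<noteq> {}" "\<tau> \<subseteq> \<sigma> \<Longrightarrow> \<tau> \<noteq> {} \<Longrightarrow> \<tau> \<in> S"
  using assms unfolding finite_simplicial_complex_def by blast+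

lemma finite_vertices:
  "finite_simplicial_complex (simplices K) \<Longrightarrow> finite (vertices K)"
  by (auto simp: finite_simplicial_complex_def vertices_def)

lemma simplex_subset_vertices: "\<sigma> \<in> simplices K \<Longrightarrow> \<sigma> \<subseteq> vertices K"
  by (auto simp: vertices_def)

lemma simplicial_map_vertices:
  "simplicial_map K L f \<Longrightarrow> f \<in> vertices K \<rightarrow> vertices L"
  unfolding simplicial_map_def vertices_def by blast

text \<open>Morphisms are \<open>undefined\<close> off the vertex set, so a restricted map can be
  evaluated on an oriented triple only once its entries are known to be vertices.\<close>

lemma positive_vertices:
  assumes "orients_two_simplices K" "(a, b, c) \<in> positive K"
  shows "a \<in> vertices K" "b \<in> vertices K" "c \<in> vertices K"
proof -
  have "{a, b, c} \<in> two_simplices K"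
    using assms by (auto simp: orients_two_simplices_def)
  then have "{a, b, c} \<subseteq> vertices K"
    by (intro simplex_subset_vertices) (simp add: two_simplices_def)
  then show "a \<in> vertices K" "b \<in> vertices K" "c \<in> vertices K" by simp_all
qed

lemma compose_image: "\<sigma> \<subseteq> A \<Longrightarrow> compose A g f ` \<sigma> = g ` f ` \<sigma>"
  by (auto simp: compose_def image_image subset_iff intro!: image_cong)

lemma simplicial_map_compose:
  assumes "simplicial_map K L f" "simplicial_map L M g"
  shows "simplicial_map K M (compose (vertices K) g f)"
  using assms by (simp add: simplicial_map_def compose_image simplex_subset_vertices)

lemma orientation_preserving_compose:
  assumes "orients_two_simplices K" "orientation_preserving K L f" "orientation_preserving L M g"
  shows "orientation_preserving K M (compose (vertices K) g f)"
  unfolding orientation_preserving_def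
proof (intro conjI ballI)
  fix \<sigma> assume s: "\<sigma> \<in> two_simplices K"
  then have "\<sigma> \<subseteq> vertices K" by (simp add: two_simplices_def simplex_subset_vertices)
  then show "compose (vertices K) g f ` \<sigma> \<in> two_simplices M"
    using s assms by (simp add: compose_image orientation_preserving_def)
next
  fix t assume t: "t \<in> positive K"
  obtain a b c where [simp]: "t = (a, b, c)" by (cases t)
  show "case t of (a, b, c) \<Rightarrow> (compose (vertices K) g f a, compose (vertices K) g f b,
      compose (vertices K) g f c) \<in> positive M"
    using t assms positive_vertices[OF assms(1), of a b c]
    by (auto simp: compose_def orientation_preserving_def)
qed

lemma is_category_D: "is_category category_D"
proof
  fix K :: "'v oriented_complex" assume "K \<in> Obj category_D"
  then have o: "orients_two_simplices K"
    by (simp add: category_D_def finite_oriented_2_complex_def)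
  have im: "(\<lambda>v\<in>vertices K. v) ` \<sigma> = \<sigma>" if "\<sigma> \<in> simplices K" for \<sigma>
    using simplex_subset_vertices[OF that] by force
  have "(\<lambda>v\<in>vertices K. v) ` \<sigma> \<in> two_simplices K" if "\<sigma> \<in> two_simplices K" for \<sigma>
    using that im[of \<sigma>] by (simp add: two_simplices_def)
  moreover have "((\<lambda>v\<in>vertices K. v) a, (\<lambda>v\<in>vertices K. v) b, (\<lambda>v\<in>vertices K. v) c) \<in> positive K"
    if "(a, b, c) \<in> positive K" for a b c
    using that positive_vertices[OF o that] by simp
  ultimately have "orientation_preserving K K (\<lambda>v\<in>vertices K. v)"
    unfolding orientation_preserving_def by blast
  moreover have "simplicial_map K K (\<lambda>v\<in>vertices K. v)"
    unfolding simplicial_map_def using im by metis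
  ultimately show "Ident category_D K \<in> Mor category_D K K"
    by (simp add: category_D_def)
next
  fix K L M N :: "'v oriented_complex" and f g h
  assume "f \<in> Mor category_D K L"
  then have "f \<in> vertices K \<rightarrow> vertices L"
    by (simp add: category_D_def simplicial_map_vertices)
  then show "Comp category_D K M N h (Comp category_D K L M g f) =
      Comp category_D K L N (Comp category_D L M N h g) f"
    by (simp add: category_D_def compose_assoc)
qed (auto simp: category_D_def finite_oriented_2_complex_def
      intro: simplicial_map_compose orientation_preserving_compose
        compose_Id[OF simplicial_map_vertices] Id_compose[OF simplicial_map_vertices])


section \<open>Components\<close>

text \<open>Components use the transitive, not the reflexive, closure; a simplex belongs to its own
  component because it meets itself, being nonempty.\<close>

lemma component_of_refl: "\<tau> \<in> S \<Longrightarrow> \<tau> \<noteq> {} \<Longrightarrow> \<tau> \<in> component_of S \<tau>"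
  by (auto simp: component_of_def)

text \<open>The chain relation is symmetric and transitive, so related simplices reach the same
  simplices. Any member may thus serve as the name of a component.\<close>

lemma component_of_eq:
  assumes "\<beta> \<in> component_of S \<alpha>"
  shows "component_of S \<beta> = component_of S \<alpha>"
proof -
  let ?R = "{(\<alpha>, \<beta>). \<alpha> \<in> S \<and> \<beta> \<in> S \<and> \<alpha> \<inter> \<beta> \<noteq> {}}"
  have "sym (?R\<^sup>+)" by (rule sym_trancl) (auto simp: sym_def)
  moreover have "(\<alpha>, \<beta>) \<in> ?R\<^sup>+" using assms by (simp add: component_of_def)
  ultimately have "(\<beta>, \<alpha>) \<in> ?R\<^sup>+" "(\<alpha>, \<beta>) \<in> ?R\<^sup>+" by (auto dest: symD)
  then show ?thesis unfolding component_of_def by (auto intro: trancl_trans)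
qed

text \<open>Intersecting simplices have intersecting images, so chains go to chains.\<close>

lemma component_of_image:
  assumes "\<And>\<alpha>. \<alpha> \<in> S \<Longrightarrow> f ` \<alpha> \<in> T"
  shows "(`) f ` component_of S \<tau> \<subseteq> component_of T (f ` \<tau>)"
proof -
  have "(f ` \<tau>, f ` \<beta>) \<in> {(\<alpha>, \<beta>). \<alpha> \<in> T \<and> \<beta> \<in> T \<and> \<alpha> \<inter> \<beta> \<noteq> {}}\<^sup>+"
    if "(\<tau>, \<beta>) \<in> {(\<alpha>, \<beta>). \<alpha> \<in> S \<and> \<beta> \<in> S \<and> \<alpha> \<inter> \<beta> \<noteq> {}}\<^sup>+" for \<beta>
    using that
  proof induction
    case (base \<beta>)
    then show ?case using assms by (intro r_into_trancl) auto
  next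
    case (step \<beta> \<gamma>)
    then have "(f ` \<beta>, f ` \<gamma>) \<in> {(\<alpha>, \<beta>). \<alpha> \<in> T \<and> \<beta> \<in> T \<and> \<alpha> \<inter> \<beta> \<noteq> {}}"
      using assms by auto
    with step.IH show ?case by (rule trancl_into_trancl)
  qed
  then show ?thesis by (auto simp: component_of_def)
qed


section \<open>Desingularization\<close>

text \<open>Guarantees that the component chosen in \<open>puncture_at\<close> is a genuine
  component of the link.\<close>

lemma opposite_edge_in_link:
  assumes "finite_simplicial_complex (simplices K)" "\<sigma> \<in> two_simplices K" "v \<in> \<sigma>"
  shows "\<sigma> - {v} \<in> link K v"
proof -
  have s: "\<sigma> \<in> simplices K" "card \<sigma> = 3" using assms(2) by (auto simp: two_simplices_def)
  have "\<sigma> \<noteq> {v}" using s(2) by auto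
  then have "\<sigma> - {v} \<noteq> {}" using assms(3) by auto
  then have "\<sigma> - {v} \<in> simplices K"
    by (intro finite_simplicial_complexD(3)[OF assms(1) s(1)]) auto
  moreover have "insert v (\<sigma> - {v}) = \<sigma>" using assms(3) by auto
  ultimately show ?thesis using s by (simp add: link_def)
qed

lemma puncture_at_in_punctures:
  assumes "finite_simplicial_complex (simplices K)" "\<sigma> \<in> two_simplices K" "v \<in> \<sigma>"
  shows "puncture_at K \<sigma> v \<in> punctures K"
  using opposite_edge_in_link[OF assms] assms(2,3)
  by (auto simp: punctures_def puncture_at_def components_of_def two_simplices_def vertices_def)

text \<open>A puncture records its vertex as first coordinate; hence triangles keep three distinct
  corners.\<close>

lemma inj_on_puncture_at: "inj_on (puncture_at K \<sigma>) A"
  by (auto simp: inj_on_def puncture_at_def)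

lemma fst_puncture_at [simp]: "fst (puncture_at K \<sigma> v) = v"
  by (simp add: puncture_at_def)

lemma simplices_desingularization:
  "simplices (desingularization K) = (\<lambda>p. {p}) ` punctures K \<union>
     {\<tau>. \<tau> \<noteq> {} \<and> (\<exists>\<sigma>\<in>two_simplices K. \<tau> \<subseteq> puncture_at K \<sigma> ` \<sigma>)}"
  by (simp only: desingularization_def Setcompr_eq_image oriented_complex.simps)

lemma vertices_desingularization:
  assumes "finite_simplicial_complex (simplices K)"
  shows "vertices (desingularization K) = punctures K"
proof (intro equalityI subsetI)
  fix p assume "p \<in> vertices (desingularization K)"
  then obtain \<tau> where "p \<in> \<tau>" "\<tau> \<in> simplices (desingularization K)"
    by (auto simp: vertices_def)
  then consider "p \<in> punctures K" | \<sigma> where "\<sigma> \<in> two_simplices K" "p \<in> puncture_at K \<sigma> ` \<sigma>"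
    unfolding simplices_desingularization by blast
  then show "p \<in> punctures K"
    by cases (auto simp: puncture_at_in_punctures[OF assms])
next
  fix p assume "p \<in> punctures K"
  then have "{p} \<in> simplices (desingularization K)"
    by (simp add: simplices_desingularization)
  then show "p \<in> vertices (desingularization K)"
    by (auto simp: vertices_def)
qed

text \<open>Each generating set has exactly three points, so its only face with three points is the
  whole of it.\<close>

lemma two_simplices_desingularization:
  "two_simplices (desingularization K) = (\<lambda>\<sigma>. puncture_at K \<sigma> ` \<sigma>) ` two_simplices K"
proof (intro equalityI subsetI)
  fix \<tau> assume "\<tau> \<in> two_simplices (desingularization K)"
  then obtain \<sigma> where s: "\<sigma> \<in> two_simplices K" "\<tau> \<subseteq> puncture_at K \<sigma> ` \<sigma>" and "card \<tau> = 3"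
    by (auto simp: two_simplices_def simplices_desingularization)
  moreover have "card (puncture_at K \<sigma> ` \<sigma>) = 3"
    using s(1) by (simp add: card_image inj_on_puncture_at two_simplices_def)
  ultimately have "\<tau> = puncture_at K \<sigma> ` \<sigma>"
    by (metis card_subset_eq card.infinite zero_neq_numeral)
  then show "\<tau> \<in> (\<lambda>\<sigma>. puncture_at K \<sigma> ` \<sigma>) ` two_simplices K" using s(1) by blast
next
  fix \<tau> assume "\<tau> \<in> (\<lambda>\<sigma>. puncture_at K \<sigma> ` \<sigma>) ` two_simplices K"
  then obtain \<sigma> where s: "\<sigma> \<in> two_simplices K" "\<tau> = puncture_at K \<sigma> ` \<sigma>" by blast
  have "card \<tau> = 3"
    using s by (simp add: card_image inj_on_puncture_at two_simplices_def)
  moreover from this have "\<tau> \<noteq> {}" by auto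
  ultimately show "\<tau> \<in> two_simplices (desingularization K)"
    using s by (auto simp: two_simplices_def simplices_desingularization)
qed

text \<open>The first coordinates recover the underlying triple, so the witnesses in the definition
  of \<open>positive\<close> are forced and the existential becomes a direct test.\<close>

lemma positive_desingularization_iff:
  "(a, b, c) \<in> positive (desingularization K) \<longleftrightarrow>
     (fst a, fst b, fst c) \<in> positive K \<and>
     (\<forall>p\<in>{a, b, c}. p = puncture_at K {fst a, fst b, fst c} (fst p))"
  (is "_ \<longleftrightarrow> ?pos \<and> ?eq")
proof
  assume "(a, b, c) \<in> positive (desingularization K)"
  then obtain x y z where "(x, y, z) \<in> positive K" "a = puncture_at K {x, y, z} x"
      "b = puncture_at K {x, y, z} y" "c = puncture_at K {x, y, z} z"
    by (auto simp: desingularization_def)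
  then show "?pos \<and> ?eq" by simp
next
  assume a: "?pos \<and> ?eq"
  then have "(a, b, c) = (puncture_at K {fst a, fst b, fst c} (fst a),
      puncture_at K {fst a, fst b, fst c} (fst b), puncture_at K {fst a, fst b, fst c} (fst c))"
    by blast
  with a show "(a, b, c) \<in> positive (desingularization K)"
    unfolding desingularization_def by auto
qed

lemma finite_oriented_2_complex_desingularization:
  assumes "finite_oriented_2_complex K"
  shows "finite_oriented_2_complex (desingularization K)"
proof -
  have fin: "finite_simplicial_complex (simplices K)"
    and dim: "two_dimensional (simplices K)" and ori: "orients_two_simplices K"
    using assms by (auto simp: finite_oriented_2_complex_def)
  have finS: "finite (simplices K)" using fin by (simp add: finite_simplicial_complex_def)
  have fin2: "finite \<sigma>" if "\<sigma> \<in> two_simplices K" for \<sigma>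
    using that by (intro card_ge_0_finite) (simp add: two_simplices_def)
  have "finite (link K v)" for v
    by (rule finite_subset[OF _ finS]) (auto simp: link_def)
  then have "finite (punctures K)"
    using finite_vertices[OF fin] by (auto simp: punctures_def components_of_def)
  moreover have "finite (\<Union>\<sigma>\<in>two_simplices K. Pow (puncture_at K \<sigma> ` \<sigma>))"
    using finS fin2 by (auto simp: two_simplices_def)
  \<comment> \<open>Finiteness comes from enclosing the simplices in singletons of punctures and
    power sets of the finitely many desingularized triangles.\<close>
  moreover have "simplices (desingularization K) \<subseteq>
      (\<lambda>p. {p}) ` punctures K \<union> (\<Union>\<sigma>\<in>two_simplices K. Pow (puncture_at K \<sigma> ` \<sigma>))"
    by (auto simp: simplices_desingularization)
  ultimately have "finite (simplices (desingularization K))"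
    by (meson finite_UnI finite_imageI finite_subset)
  moreover have "finite \<tau>" "\<tau> \<noteq> {}" "\<rho> \<subseteq> \<tau> \<Longrightarrow> \<rho> \<noteq> {} \<Longrightarrow> \<rho> \<in> simplices (desingularization K)"
    if t: "\<tau> \<in> simplices (desingularization K)" for \<rho> \<tau>
  proof -
    consider p where "p \<in> punctures K" "\<tau> = {p}"
      | \<sigma> where "\<sigma> \<in> two_simplices K" "\<tau> \<subseteq> puncture_at K \<sigma> ` \<sigma>" "\<tau> \<noteq> {}"
      using t unfolding simplices_desingularization by blast
    then have "finite \<tau> \<and> \<tau> \<noteq> {} \<and>
        (\<rho> \<subseteq> \<tau> \<longrightarrow> \<rho> \<noteq> {} \<longrightarrow> \<rho> \<in> simplices (desingularization K))"
    proof cases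
      case 1
      then show ?thesis using t by (auto simp: subset_singleton_iff)
    next
      case 2
      have "finite \<tau>" using 2(2) fin2[OF 2(1)] by (simp add: finite_subset)
      moreover have "\<rho> \<in> simplices (desingularization K)" if "\<rho> \<subseteq> \<tau>" "\<rho> \<noteq> {}"
        using that 2(1,2) unfolding simplices_desingularization by blast
      ultimately show ?thesis using 2(3) by blast
    qed
    then show "finite \<tau>" "\<tau> \<noteq> {}"
      "\<rho> \<subseteq> \<tau> \<Longrightarrow> \<rho> \<noteq> {} \<Longrightarrow> \<rho> \<in> simplices (desingularization K)"
      by blast+
  qed
  ultimately have "finite_simplicial_complex (simplices (desingularization K))"
    unfolding finite_simplicial_complex_def by blast
  moreover have "two_dimensional (simplices (desingularization K))"
  proof -
    have "card \<tau> \<le> 3" if "\<sigma> \<in> two_simplices K" "\<tau> \<subseteq> puncture_at K \<sigma> ` \<sigma>" for \<sigma> \<tau>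
    proof -
      have "card \<tau> \<le> card (puncture_at K \<sigma> ` \<sigma>)"
        using that fin2 by (intro card_mono) auto
      also have "\<dots> \<le> card \<sigma>" using that fin2 by (intro card_image_le) auto
      finally show ?thesis using that by (simp add: two_simplices_def)
    qed
    moreover have "\<exists>\<tau>\<in>simplices (desingularization K). card \<tau> = 3"
      if "simplices (desingularization K) \<noteq> {}"
    proof -
      \<comment> \<open>Every simplex of the desingularization stems from a vertex or a triangle of
        \<open>K\<close>; a nonempty \<open>K\<close> contains a triangle, which survives.\<close>
      have "simplices K \<noteq> {}"
        using that by (auto simp: simplices_desingularization punctures_def vertices_def
            two_simplices_def)
      then obtain \<sigma> where "\<sigma> \<in> two_simplices K"
        using dim by (auto simp: two_dimensional_def two_simplices_def)
      then have "puncture_at K \<sigma> ` \<sigma> \<in> two_simplices (desingularization K)"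
        by (auto simp: two_simplices_desingularization)
      then show ?thesis by (auto simp: two_simplices_def)
    qed
    ultimately show ?thesis
      unfolding two_dimensional_def by (auto simp: simplices_desingularization)
  qed
  moreover have "orients_two_simplices (desingularization K)"
    unfolding orients_two_simplices_def
  proof (intro conjI allI impI ballI)
    fix t assume t: "t \<in> positive (desingularization K)"
    obtain a b c where [simp]: "t = (a, b, c)" by (cases t)
    let ?\<sigma> = "{fst a, fst b, fst c}"
    have pos: "(fst a, fst b, fst c) \<in> positive K"
      and eq: "\<And>p. p \<in> {a, b, c} \<Longrightarrow> p = puncture_at K ?\<sigma> (fst p)"
      using t by (auto simp only: \<open>t = (a, b, c)\<close> positive_desingularization_iff)
    have "{a, b, c} = puncture_at K ?\<sigma> ` ?\<sigma>"
      using eq[of a] eq[of b] eq[of c] by auto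
    moreover have "?\<sigma> \<in> two_simplices K" and pos': "(fst b, fst c, fst a) \<in> positive K"
      using ori pos by (auto simp: orients_two_simplices_def)
    ultimately have "{a, b, c} \<in> two_simplices (desingularization K)"
      unfolding two_simplices_desingularization by blast
    \<comment> \<open>\<open>puncture_at\<close> sees only the vertex set, so rotating the triple
      leaves the three punctures unchanged.\<close>
    moreover have "{fst b, fst c, fst a} = ?\<sigma>" by auto
    then have "(b, c, a) \<in> positive (desingularization K)"
      using eq pos' unfolding positive_desingularization_iff by auto
    ultimately show "case t of (a, b, c) \<Rightarrow>
        {a, b, c} \<in> two_simplices (desingularization K) \<and>
        (b, c, a) \<in> positive (desingularization K)"
      by simp
  next
    fix a b c :: "'a \<times> 'a set set"
    assume "{a, b, c} \<in> two_simplices (desingularization K)"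
    then obtain \<sigma> where s: "\<sigma> \<in> two_simplices K" and e: "{a, b, c} = puncture_at K \<sigma> ` \<sigma>"
      by (auto simp: two_simplices_desingularization)
    \<comment> \<open>Both orderings lie over the same \<sigma>, so the choice between them is the
      one already made in \<open>K\<close>.\<close>
    have "fst ` {a, b, c} = \<sigma>" unfolding e by (simp add: image_image)
    then have \<sigma>: "\<sigma> = {fst a, fst b, fst c}" "\<sigma> = {fst b, fst a, fst c}" by auto
    have p: "p = puncture_at K \<sigma> (fst p)" if "p \<in> {a, b, c}" for p
      using that unfolding e by auto
    have "(a, b, c) \<in> positive (desingularization K) \<longleftrightarrow> (fst a, fst b, fst c) \<in> positive K"
      using p by (auto simp: positive_desingularization_iff \<sigma>(1)[symmetric])
    moreover have "(b, a, c) \<in> positive (desingularization K) \<longleftrightarrow> (fst b, fst a, fst c) \<in> positive K"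
      using p by (auto simp: positive_desingularization_iff \<sigma>(2)[symmetric])
    ultimately show "(a, b, c) \<in> positive (desingularization K) \<longleftrightarrow>
        (b, a, c) \<notin> positive (desingularization K)"
      using ori s \<sigma>(1) by (auto simp: orients_two_simplices_def)
  qed
  ultimately show ?thesis by (simp add: finite_oriented_2_complex_def)
qed

section \<open>Induced maps between desingularizations\<close>

definition nondegenerate_map :: "'v oriented_complex \<Rightarrow> 'w oriented_complex \<Rightarrow> ('v \<Rightarrow> 'w) \<Rightarrow> bool" where
  "nondegenerate_map K L f \<longleftrightarrow> simplicial_map K L f \<and> (\<forall>\<sigma>\<in>simplices K. inj_on f \<sigma>)"

text \<open>This is the formula of \<open>map_Y\<close> with an arbitrary simplicial map in place of
  \<open>map_X\<close>, so that its functoriality can be proved without reference to groups.\<close>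

definition desingularization_map ::
    "'v oriented_complex \<Rightarrow> 'w oriented_complex \<Rightarrow> ('v \<Rightarrow> 'w) \<Rightarrow> 'v \<times> 'v set set \<Rightarrow> 'w \<times> 'w set set" where
  "desingularization_map K L f = (\<lambda>(v, c)\<in>vertices (desingularization K).
     (f v, THE d. d \<in> components_of (link L (f v)) \<and> (`) f ` c \<subseteq> d))"

text \<open>Injectivity on \<open>insert v \<tau>\<close> keeps \<open>f v\<close> off the image of
  \<tau>; without it the star of \<open>v\<close> could fold onto the image vertex.\<close>

lemma link_image:
  assumes "nondegenerate_map K L f" "\<tau> \<in> link K v"
  shows "f ` \<tau> \<in> link L (f v)"
proof -
  have t: "\<tau> \<in> simplices K" "v \<notin> \<tau>" "insert v \<tau> \<in> simplices K"
    using assms(2) by (auto simp: link_def)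
  then have "f ` \<tau> \<in> simplices L" "f ` insert v \<tau> \<in> simplices L" "inj_on f (insert v \<tau>)"
    using assms(1) unfolding nondegenerate_map_def simplicial_map_def by blast+
  then show ?thesis using t(2) by (auto simp: link_def)
qed

text \<open>Evaluates the definite description. Existence is the transport of chains; uniqueness
  holds because a candidate \<open>d\<close> contains the image of \<tau> and a component is
  determined by any member.\<close>

lemma desingularization_map_component:
  assumes K: "finite_simplicial_complex (simplices K)"
    and f: "nondegenerate_map K L f"
    and t: "\<tau> \<in> link K v"
  shows "desingularization_map K L f (v, component_of (link K v) \<tau>) =
    (f v, component_of (link L (f v)) (f ` \<tau>))"
proof -
  let ?c = "component_of (link K v) \<tau>" and ?d = "component_of (link L (f v)) (f ` \<tau>)"
  have "v \<in> vertices K" using t by (auto simp: link_def vertices_def)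
  then have vert: "(v, ?c) \<in> vertices (desingularization K)"
    using t by (auto simp: vertices_desingularization[OF K] punctures_def components_of_def)
  have ne: "\<tau> \<noteq> {}" using t finite_simplicial_complexD(2)[OF K] by (auto simp: link_def)
  have ft: "f ` \<tau> \<in> link L (f v)" by (rule link_image[OF f t])
  have "(THE d. d \<in> components_of (link L (f v)) \<and> (`) f ` ?c \<subseteq> d) = ?d"
  proof (rule the_equality)
    show "?d \<in> components_of (link L (f v)) \<and> (`) f ` ?c \<subseteq> ?d"
      using ft component_of_image[of "link K v" f "link L (f v)" \<tau>] link_image[OF f]
      by (auto simp: components_of_def)
  next
    fix d assume d: "d \<in> components_of (link L (f v)) \<and> (`) f ` ?c \<subseteq> d"
    then have "f ` \<tau> \<in> d" using component_of_refl[OF t ne] by blast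
    moreover obtain \<alpha> where "d = component_of (link L (f v)) \<alpha>"
      using d by (auto simp: components_of_def)
    ultimately show "d = ?d" using component_of_eq by metis
  qed
  then show ?thesis using vert by (simp add: desingularization_map_def)
qed

lemma desingularization_map_puncture_at:
  assumes K: "finite_simplicial_complex (simplices K)" and f: "nondegenerate_map K L f"
    and s: "\<sigma> \<in> two_simplices K" "v \<in> \<sigma>"
  shows "desingularization_map K L f (puncture_at K \<sigma> v) = puncture_at L (f ` \<sigma>) (f v)"
proof -
  have "inj_on f \<sigma>" using f s by (auto simp: nondegenerate_map_def two_simplices_def)
  \<comment> \<open>Injectivity on \<sigma> lets image and difference commute: opposite edges go to
    opposite edges.\<close>
  then have "f ` (\<sigma> - {v}) = f ` \<sigma> - {f v}"
    using s(2) by (auto simp: inj_on_def)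
  then show ?thesis
    using desingularization_map_component[OF K f opposite_edge_in_link[OF K s]]
    by (simp add: puncture_at_def)
qed

lemma vertices_desingularizationE:
  assumes "finite_simplicial_complex (simplices K)" "p \<in> vertices (desingularization K)"
  obtains v \<tau> where "v \<in> vertices K" "\<tau> \<in> link K v" "p = (v, component_of (link K v) \<tau>)"
  using assms by (auto simp: vertices_desingularization punctures_def components_of_def)

lemma desingularization_map_morphism:
  assumes K: "finite_oriented_2_complex K"
    and f: "nondegenerate_map K L f" "orientation_preserving K L f"
  shows "simplicial_map (desingularization K) (desingularization L) (desingularization_map K L f)"
    and "orientation_preserving (desingularization K) (desingularization L)
      (desingularization_map K L f)"
proof -
  let ?f = "desingularization_map K L f"
  have K': "finite_simplicial_complex (simplices K)"
    using K by (simp add: finite_oriented_2_complex_def)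
  have two: "f ` \<sigma> \<in> two_simplices L" if "\<sigma> \<in> two_simplices K" for \<sigma>
    using f(2) that by (auto simp: orientation_preserving_def)
  have im: "?f ` puncture_at K \<sigma> ` \<sigma> = puncture_at L (f ` \<sigma>) ` f ` \<sigma>"
    if "\<sigma> \<in> two_simplices K" for \<sigma>
    using desingularization_map_puncture_at[OF K' f(1) that] by (auto simp: image_image)
  have pun: "?f p \<in> punctures L" if p: "p \<in> punctures K" for p
  proof -
    have "p \<in> vertices (desingularization K)" using p by (simp add: vertices_desingularization[OF K'])
    then obtain v \<tau> where v: "v \<in> vertices K" "\<tau> \<in> link K v" "p = (v, component_of (link K v) \<tau>)"
      by (rule vertices_desingularizationE[OF K'])
    have "f v \<in> vertices L"
      using f(1) v(1) simplicial_map_vertices by (fastforce simp: nondegenerate_map_def)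
    then show ?thesis
      using v link_image[OF f(1) v(2)] desingularization_map_component[OF K' f(1) v(2)]
      by (auto simp: punctures_def components_of_def)
  qed
  show "simplicial_map (desingularization K) (desingularization L) ?f"
    unfolding simplicial_map_def
  proof
    fix \<tau> assume "\<tau> \<in> simplices (desingularization K)"
    then consider p where "p \<in> punctures K" "\<tau> = {p}"
      | \<sigma> where "\<sigma> \<in> two_simplices K" "\<tau> \<subseteq> puncture_at K \<sigma> ` \<sigma>" "\<tau> \<noteq> {}"
      by (auto simp: simplices_desingularization)
    then show "?f ` \<tau> \<in> simplices (desingularization L)"
    proof cases
      case 1
      then show ?thesis using pun by (auto simp: simplices_desingularization)
    next
      case 2
      \<comment> \<open>Whole desingularized triangles correspond by \<open>im\<close>, and their
        faces follow by monotonicity of images.\<close>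
      have "?f ` \<tau> \<subseteq> puncture_at L (f ` \<sigma>) ` f ` \<sigma>"
        using image_mono[OF 2(2), of ?f] im[OF 2(1)] by simp
      then have "\<exists>\<rho>\<in>two_simplices L. ?f ` \<tau> \<subseteq> puncture_at L \<rho> ` \<rho>"
        using two 2(1) by blast
      then show ?thesis using 2(3) by (simp add: simplices_desingularization)
    qed
  qed
  show "orientation_preserving (desingularization K) (desingularization L) ?f"
    unfolding orientation_preserving_def
  proof (intro conjI ballI)
    fix \<tau> assume "\<tau> \<in> two_simplices (desingularization K)"
    then show "?f ` \<tau> \<in> two_simplices (desingularization L)"
      using im two by (auto simp: two_simplices_desingularization)
  next
    fix t assume "t \<in> positive (desingularization K)"
    then obtain a b c where pos: "(a, b, c) \<in> positive K"
      and t: "t = (puncture_at K {a, b, c} a, puncture_at K {a, b, c} b, puncture_at K {a, b, c} c)"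
      by (auto simp: desingularization_def)
    have "{a, b, c} \<in> two_simplices K"
      using K pos by (auto simp: finite_oriented_2_complex_def orients_two_simplices_def)
    note pa = desingularization_map_puncture_at[OF K' f(1) this]
    have "(f a, f b, f c) \<in> positive L"
      using f(2) pos by (auto simp: orientation_preserving_def)
    then show "case t of (p, q, r) \<Rightarrow> (?f p, ?f q, ?f r) \<in> positive (desingularization L)"
      unfolding t using pa[of a] pa[of b] pa[of c] by (auto simp: positive_desingularization_iff)
  qed
qed

lemma nondegenerate_map_identity: "nondegenerate_map K K (\<lambda>v\<in>vertices K. v)"
proof -
  have "(\<lambda>v\<in>vertices K. v) ` \<sigma> = \<sigma>" "inj_on (\<lambda>v\<in>vertices K. v) \<sigma>" if "\<sigma> \<in> simplices K" for \<sigma>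
    using simplex_subset_vertices[OF that] by (force simp: inj_on_def)+
  then show ?thesis by (simp add: nondegenerate_map_def simplicial_map_def)
qed

lemma desingularization_map_identity:
  assumes K: "finite_simplicial_complex (simplices K)"
  shows "desingularization_map K K (\<lambda>v\<in>vertices K. v) = (\<lambda>p\<in>vertices (desingularization K). p)"
proof (rule extensionalityI)
  fix p assume p: "p \<in> vertices (desingularization K)"
  then obtain v \<tau> where v: "v \<in> vertices K" "\<tau> \<in> link K v" "p = (v, component_of (link K v) \<tau>)"
    by (rule vertices_desingularizationE[OF K])
  have "\<tau> \<subseteq> vertices K" using v(2) by (auto simp: link_def vertices_def)
  then have "(\<lambda>v\<in>vertices K. v) ` \<tau> = \<tau>" by force
  then show "desingularization_map K K (\<lambda>v\<in>vertices K. v) p =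
      (\<lambda>p\<in>vertices (desingularization K). p) p"
    using p v desingularization_map_component[OF K nondegenerate_map_identity v(2)] by simp
qed (simp_all add: desingularization_map_def)

lemma nondegenerate_map_compose:
  assumes "nondegenerate_map K L f" "nondegenerate_map L M g"
  shows "nondegenerate_map K M (compose (vertices K) g f)"
proof -
  have "inj_on (compose (vertices K) g f) \<sigma>" if s: "\<sigma> \<in> simplices K" for \<sigma>
  proof -
    have "inj_on f \<sigma>" "inj_on g (f ` \<sigma>)"
      using assms s by (auto simp: nondegenerate_map_def simplicial_map_def)
    then show ?thesis
      using simplex_subset_vertices[OF s] by (auto simp: inj_on_def compose_def subset_iff)
  qed
  then show ?thesis
    using assms by (auto simp: nondegenerate_map_def intro: simplicial_map_compose)
qed

text \<open>With a link simplex \<tau> as representative, both sides give the component of the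
  twofold image of \<tau>; the second application is legitimate because \<open>f\<close> maps \<tau>
  into the link of \<open>f v\<close>.\<close>

lemma desingularization_map_compose:
  assumes K: "finite_simplicial_complex (simplices K)" and L: "finite_simplicial_complex (simplices L)"
    and f: "nondegenerate_map K L f" and g: "nondegenerate_map L M g"
  shows "desingularization_map K M (compose (vertices K) g f) =
    compose (vertices (desingularization K)) (desingularization_map L M g) (desingularization_map K L f)"
proof (rule extensionalityI)
  fix p assume p: "p \<in> vertices (desingularization K)"
  then obtain v \<tau> where v: "v \<in> vertices K" "\<tau> \<in> link K v" "p = (v, component_of (link K v) \<tau>)"
    by (rule vertices_desingularizationE[OF K])
  have "\<tau> \<subseteq> vertices K" using v(2) by (auto simp: link_def vertices_def)
  then have "compose (vertices K) g f ` \<tau> = g ` f ` \<tau>" by (rule compose_image)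
  moreover have "compose (vertices K) g f v = g (f v)" using v(1) by (simp add: compose_def)
  ultimately show "desingularization_map K M (compose (vertices K) g f) p =
      compose (vertices (desingularization K)) (desingularization_map L M g)
        (desingularization_map K L f) p"
    using p v desingularization_map_component[OF K f v(2)]
      desingularization_map_component[OF L g link_image[OF f v(2)]]
      desingularization_map_component[OF K nondegenerate_map_compose[OF f g] v(2)]
    by (simp add: compose_eq)
qed (simp_all add: desingularization_map_def compose_extensional)


section \<open>The complex \<open>X(G)\<close>\<close>

lemma noncommuting_sym: "(x, y) \<in> noncommuting G \<Longrightarrow> (y, x) \<in> noncommuting G"
  by (auto simp: noncommuting_def)

lemma noncommuting_distinct: "(x, y) \<in> noncommuting G \<Longrightarrow> x \<noteq> y"
  by (auto simp: noncommuting_def)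

lemma noncentral_iff: "x \<in> carrier G - center G \<longleftrightarrow> (\<exists>y. (x, y) \<in> noncommuting G)"
  by (auto simp: noncommuting_def center_def)

text \<open>Cancelling x on the left, or y on the right, reduces each claim to xy and yx being
  different. These are the edges from the first two corners of a triangle to its third, which is
  thereby noncentral.\<close>

lemma (in group) noncommuting_mult:
  assumes "(x, y) \<in> noncommuting G"
  shows "(x, x \<otimes> y) \<in> noncommuting G" "(y, x \<otimes> y) \<in> noncommuting G"
proof -
  have x: "x \<in> carrier G" and y: "y \<in> carrier G" and ne: "x \<otimes> y \<noteq> y \<otimes> x"
    using assms by (auto simp: noncommuting_def)
  have "x \<otimes> (x \<otimes> y) \<noteq> x \<otimes> (y \<otimes> x)" "(y \<otimes> x) \<otimes> y \<noteq> (x \<otimes> y) \<otimes> y"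
    using x y ne by simp_all
  then show "(x, x \<otimes> y) \<in> noncommuting G" "(y, x \<otimes> y) \<in> noncommuting G"
    using x y by (simp_all add: noncommuting_def m_assoc)
qed

lemma simplices_complex_X_cases:
  assumes "\<sigma> \<in> simplices (complex_X G)"
  obtains (vertex) x i where "x \<in> carrier G - center G" "i \<in> {1, 2}" "\<sigma> = {(x, i)}"
    | (edge) x y i where "(x, y) \<in> noncommuting G" "i \<in> {1, 2}" "\<sigma> = {(x, 1), (y, i)}"
    | (triangle) x y where "(x, y) \<in> noncommuting G" "\<sigma> = {(x, 1), (y, 1), (x \<otimes>\<^bsub>G\<^esub> y, 2)}"
  using assms unfolding complex_X_def by fastforce

lemma complex_X_simplexI:
  shows "x \<in> carrier G - center G \<Longrightarrow> i \<in> {1, 2} \<Longrightarrow> {(x, i)} \<in> simplices (complex_X G)"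
    and "(x, y) \<in> noncommuting G \<Longrightarrow> i \<in> {1, 2} \<Longrightarrow> {(x, 1), (y, i)} \<in> simplices (complex_X G)"
    and "(x, y) \<in> noncommuting G \<Longrightarrow>
      {(x, 1), (y, 1), (x \<otimes>\<^bsub>G\<^esub> y, 2)} \<in> simplices (complex_X G)"
  unfolding complex_X_def by auto

text \<open>The position of the vertex with level \<open>2\<close> shows which rotation of the
  defining ordering is present, and the level \<open>1\<close> entries then give back x and
  y.\<close>

lemma complex_X_positive_iff:
  "((x, 1), (y, 1), (z, 2)) \<in> positive (complex_X G) \<longleftrightarrow> (x, y) \<in> noncommuting G \<and> z = x \<otimes>\<^bsub>G\<^esub> y"
  "((y, 1), (z, 2), (x, 1)) \<in> positive (complex_X G) \<longleftrightarrow> (x, y) \<in> noncommuting G \<and> z = x \<otimes>\<^bsub>G\<^esub> y"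
  "((z, 2), (x, 1), (y, 1)) \<in> positive (complex_X G) \<longleftrightarrow> (x, y) \<in> noncommuting G \<and> z = x \<otimes>\<^bsub>G\<^esub> y"
  unfolding complex_X_def by auto

lemma two_simplices_complex_X:
  "two_simplices (complex_X G) =
    {{(x, 1), (y, 1), (x \<otimes>\<^bsub>G\<^esub> y, 2)} | x y. (x, y) \<in> noncommuting G}"
proof -
  have "\<exists>x y. \<sigma> = {(x, 1), (y, 1), (x \<otimes>\<^bsub>G\<^esub> y, 2)} \<and> (x, y) \<in> noncommuting G"
    if "\<sigma> \<in> simplices (complex_X G)" "card \<sigma> = 3" for \<sigma>
    using that(1)
  proof (cases rule: simplices_complex_X_cases)
    case (edge x y i)
    have "card \<sigma> \<le> 2" unfolding edge(3) by (simp add: card_insert_if)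
    with that(2) show ?thesis by simp
  qed (use that(2) in auto)
  moreover have "{(x, 1), (y, 1), (x \<otimes>\<^bsub>G\<^esub> y, 2)} \<in> two_simplices (complex_X G)"
    if "(x, y) \<in> noncommuting G" for x y
    using complex_X_simplexI(3)[OF that] noncommuting_distinct[OF that]
    by (simp add: two_simplices_def)
  ultimately show ?thesis unfolding two_simplices_def by blast
qed

lemma vertices_complex_X: "vertices (complex_X G) = (carrier G - center G) \<times> {1, 2}"
  if "group G"
proof (intro equalityI subsetI)
  fix v assume "v \<in> vertices (complex_X G)"
  then obtain \<sigma> where "v \<in> \<sigma>" "\<sigma> \<in> simplices (complex_X G)" by (auto simp: vertices_def)
  from this(2,1) show "v \<in> (carrier G - center G) \<times> {1, 2}"
  proof (cases rule: simplices_complex_X_cases)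
    case (edge x y i)
    then show ?thesis using \<open>v \<in> \<sigma>\<close> noncommuting_sym[OF edge(1)] noncentral_iff by fastforce
  next
    case (triangle x y)
    then show ?thesis
      using \<open>v \<in> \<sigma>\<close> noncommuting_sym[OF triangle(1)] noncentral_iff
        noncommuting_sym[OF group.noncommuting_mult(1)[OF \<open>group G\<close> triangle(1)]] by fastforce
  qed auto
next
  fix v assume v: "v \<in> (carrier G - center G) \<times> {1, 2 :: nat}"
  obtain x i where "v = (x, i)" by (cases v)
  then have "{v} \<in> simplices (complex_X G)" using v by (auto intro: complex_X_simplexI(1))
  then show "v \<in> vertices (complex_X G)" by (auto simp: vertices_def)
qed

lemma subset_triple_cases:
  assumes "\<tau> \<subseteq> {a, b, c}" "\<tau> \<noteq> {}"
  shows "\<tau> \<in> {{a}, {b}, {c}, {a, b}, {a, c}, {b, c}, {a, b, c}}"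
proof -
  have "\<tau> \<in> Pow {a, b, c}" using assms(1) by simp
  also have "Pow {a, b, c} = {{}, {c}, {b}, {b, c}, {a}, {a, c}, {a, b}, {a, b, c}}"
    by (simp only: Pow_insert Pow_empty image_insert image_empty Un_insert_left Un_empty_left)
  finally show ?thesis using assms(2) by (elim insertE emptyE) simp_all
qed

lemma triple_orderings:
  assumes "{a, b, c} = {p, q, r}" "p \<noteq> q" "p \<noteq> r" "q \<noteq> r"
  shows "(a, b, c) \<in> {(p, q, r), (q, r, p), (r, p, q), (q, p, r), (p, r, q), (r, q, p)}"
proof -
  have "a \<in> {p, q, r}" "b \<in> {p, q, r}" "c \<in> {p, q, r}"
    "p \<in> {a, b, c}" "q \<in> {a, b, c}" "r \<in> {a, b, c}"
    using assms(1) by blast+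
  with assms(2-4) show ?thesis by auto
qed

lemma finite_oriented_2_complex_X:
  assumes "group G" "finite (carrier G)"
  shows "finite_oriented_2_complex (complex_X G)"
proof -
  interpret group G by fact
  let ?X = "complex_X G"
  have "\<tau> \<in> simplices ?X" if "\<sigma> \<in> simplices ?X" "\<tau> \<subseteq> \<sigma>" "\<tau> \<noteq> {}" for \<sigma> \<tau>
  proof -
    have sing: "{v} \<in> simplices ?X" if "v \<in> \<sigma>" for v
    proof -
      have "v \<in> vertices ?X" using that \<open>\<sigma> \<in> simplices ?X\<close> by (auto simp: vertices_def)
      then show ?thesis
        by (cases v) (auto simp: vertices_complex_X[OF assms(1)] intro: complex_X_simplexI(1))
    qed
    show ?thesis using that(1)
    proof (cases rule: simplices_complex_X_cases)
      case (vertex x i)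
      then show ?thesis using that by (auto simp: subset_singleton_iff)
    next
      case (edge x y i)
      \<comment> \<open>Repeating the last entry lets the lemma on triples treat an edge.\<close>
      then have "\<tau> \<in> {{(x, 1)}, {(y, i)}, {(x, 1), (y, i)}}"
        using that subset_triple_cases[of \<tau> "(x, 1)" "(y, i)" "(y, i)"] by auto
      then show ?thesis using that(1) sing edge(3) by auto
    next
      case (triangle x y)
      have "{{(x, 1)}, {(y, 1)}, {(x \<otimes>\<^bsub>G\<^esub> y, 2)}, {(x, 1), (y, 1)}, {(x, 1), (x \<otimes>\<^bsub>G\<^esub> y, 2)},
          {(y, 1), (x \<otimes>\<^bsub>G\<^esub> y, 2)}, {(x, 1), (y, 1), (x \<otimes>\<^bsub>G\<^esub> y, 2)}} \<subseteq> simplices ?X"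
        unfolding insert_subset
      proof (intro conjI empty_subsetI)
        show "{(x, 1), (y, 1), (x \<otimes>\<^bsub>G\<^esub> y, 2)} \<in> simplices ?X"
          by (rule complex_X_simplexI(3)[OF triangle(1)])
        show "{(x, 1), (y, 1)} \<in> simplices ?X"
          by (rule complex_X_simplexI(2)[OF triangle(1)]) simp
        show "{(x, 1), (x \<otimes>\<^bsub>G\<^esub> y, 2)} \<in> simplices ?X"
          by (rule complex_X_simplexI(2)[OF noncommuting_mult(1)[OF triangle(1)]]) simp
        show "{(y, 1), (x \<otimes>\<^bsub>G\<^esub> y, 2)} \<in> simplices ?X"
          by (rule complex_X_simplexI(2)[OF noncommuting_mult(2)[OF triangle(1)]]) simp
      qed (use sing triangle(2) in auto)
      then show ?thesis
        using subset_triple_cases[OF that(2)[unfolded triangle(2)] that(3)] by blast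
    qed
  qed
  moreover have "finite \<sigma> \<and> \<sigma> \<noteq> {} \<and> card \<sigma> \<le> 3" if "\<sigma> \<in> simplices ?X" for \<sigma>
    using that by (cases rule: simplices_complex_X_cases) (auto simp: card_insert_if)
  moreover have "finite (simplices ?X)"
  proof (rule finite_subset)
    show "simplices ?X \<subseteq> Pow ((carrier G - center G) \<times> {1, 2})"
      using simplex_subset_vertices[of _ ?X] by (auto simp: vertices_complex_X[OF assms(1)])
  qed (use assms(2) in simp)
  moreover have "\<exists>\<sigma>\<in>simplices ?X. card \<sigma> = 3" if ne: "simplices ?X \<noteq> {}"
  proof -
    obtain \<sigma> where "\<sigma> \<in> simplices ?X" using ne by blast
    \<comment> \<open>Even a lone vertex yields a triangle, since a noncentral element fails to
      commute with something.\<close>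
    then have "\<exists>x y. (x, y) \<in> noncommuting G"
    proof (cases rule: simplices_complex_X_cases)
      case (vertex x i)
      then show ?thesis using noncentral_iff[of x G] by blast
    qed blast+
    then obtain x y where xy: "(x, y) \<in> noncommuting G" by blast
    then have "{(x, 1), (y, 1), (x \<otimes>\<^bsub>G\<^esub> y, 2)} \<in> two_simplices ?X"
      by (auto simp: two_simplices_complex_X)
    then show ?thesis by (auto simp: two_simplices_def)
  qed
  moreover have "orients_two_simplices ?X"
  proof -
    have "{a, b, c} \<in> two_simplices ?X \<and> (b, c, a) \<in> positive ?X"
      if "(a, b, c) \<in> positive ?X" for a b c
      using that unfolding two_simplices_complex_X
      by (auto simp: complex_X_def; blast)
    moreover have "(a, b, c) \<in> positive ?X \<longleftrightarrow> (b, a, c) \<notin> positive ?X"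
      if "{a, b, c} \<in> two_simplices ?X" for a b c
    proof -
      obtain x y where xy: "(x, y) \<in> noncommuting G"
        and eq: "{a, b, c} = {(x, 1), (y, 1), (x \<otimes>\<^bsub>G\<^esub> y, 2)}"
        using \<open>{a, b, c} \<in> two_simplices ?X\<close> by (auto simp: two_simplices_complex_X)
      have ne: "x \<noteq> y" "x \<otimes>\<^bsub>G\<^esub> y \<noteq> y \<otimes>\<^bsub>G\<^esub> x" "y \<otimes>\<^bsub>G\<^esub> x \<noteq> x \<otimes>\<^bsub>G\<^esub> y"
        using xy by (auto simp: noncommuting_def)
      \<comment> \<open>The first three orderings are positive through (x,y). The others could be
        positive only through (y,x), whose third corner is yx rather than xy.\<close>
      have "(a, b, c) \<in> {((x, 1), (y, 1), (x \<otimes>\<^bsub>G\<^esub> y, 2)), ((y, 1), (x \<otimes>\<^bsub>G\<^esub> y, 2), (x, 1)),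
          ((x \<otimes>\<^bsub>G\<^esub> y, 2), (x, 1), (y, 1)), ((y, 1), (x, 1), (x \<otimes>\<^bsub>G\<^esub> y, 2)),
          ((x, 1), (x \<otimes>\<^bsub>G\<^esub> y, 2), (y, 1)), ((x \<otimes>\<^bsub>G\<^esub> y, 2), (y, 1), (x, 1))}"
        using ne(1) by (intro triple_orderings[OF eq]) auto
      then show ?thesis
        using xy noncommuting_sym[OF xy] ne
        \<comment> \<open>Levels must remain \<open>1\<close>: rewritten to \<open>Suc 0\<close>,
          the triples would no longer match the criteria.\<close>
        by (auto simp: complex_X_positive_iff simp del: One_nat_def)
    qed
    ultimately show ?thesis unfolding orients_two_simplices_def by blast
  qed
  ultimately show ?thesis
    by (auto simp: finite_oriented_2_complex_def finite_simplicial_complex_def two_dimensional_def)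
qed

lemma map_X_apply:
  assumes "\<sigma> \<in> simplices (complex_X G)" "(x, i) \<in> \<sigma>"
  shows "map_X G f (x, i) = (f x, i)"
  using assms by (auto simp: map_X_def vertices_def)

lemma map_X_image:
  "\<sigma> \<in> simplices (complex_X G) \<Longrightarrow> map_X G f ` \<sigma> = (\<lambda>(x, i). (f x, i)) ` \<sigma>"
  by (rule image_cong) (auto simp: map_X_apply)

lemma map_X_nondegenerate:
  assumes "group G" "group H" "injective_on_commutators G H f"
  shows "nondegenerate_map (complex_X G) (complex_X H) (map_X G f)"
proof -
  have hom: "f (x \<otimes>\<^bsub>G\<^esub> y) = f x \<otimes>\<^bsub>H\<^esub> f y" if "(x, y) \<in> noncommuting G" for x y
    using assms(3) that by (auto simp: injective_on_commutators_def noncommuting_def hom_def)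
  note nc = noncommuting_image[OF assms]
  have "map_X G f ` \<sigma> \<in> simplices (complex_X H) \<and> inj_on (map_X G f) \<sigma>"
    if s: "\<sigma> \<in> simplices (complex_X G)" for \<sigma>
  proof -
    \<comment> \<open>The cases are checked for the unrestricted formula, which agrees with
      \<open>map_X\<close> on every simplex.\<close>
    have "(\<lambda>(x, i). (f x, i)) ` \<sigma> \<in> simplices (complex_X H) \<and> inj_on (\<lambda>(x, i). (f x, i)) \<sigma>"
      using s
    proof (cases rule: simplices_complex_X_cases)
      case (vertex x i)
      then have "f x \<in> carrier H - center H" using nc noncentral_iff by metis
      then show ?thesis using vertex complex_X_simplexI(1)[of "f x" H i] by simp
    next
      case (edge x y i)
      have "f x \<noteq> f y" using noncommuting_distinct[OF nc[OF edge(1)]] .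
      then show ?thesis using edge complex_X_simplexI(2)[OF nc[OF edge(1)] edge(2)] by auto
    next
      case (triangle x y)
      have "f x \<noteq> f y" using noncommuting_distinct[OF nc[OF triangle(1)]] .
      then have "inj_on (\<lambda>(x, i). (f x, i)) \<sigma>"
        unfolding triangle(2) by (auto simp: inj_on_def)
      then show ?thesis
        using complex_X_simplexI(3)[OF nc[OF triangle(1)]] hom[OF triangle(1)]
        by (simp add: triangle(2))
    qed
    moreover have "inj_on (map_X G f) \<sigma> \<longleftrightarrow> inj_on (\<lambda>(x, i). (f x, i)) \<sigma>"
      by (rule inj_on_cong) (auto simp: map_X_apply[OF s])
    ultimately show ?thesis using map_X_image[OF s] by metis
  qed
  then show ?thesis by (simp add: nondegenerate_map_def simplicial_map_def)
qed

text \<open>A positive triple is a rotation of the one built from some pair (x,y); multiplicativity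
  sends it to the same rotation for the image pair, again noncommuting.\<close>

lemma map_X_orientation_preserving:
  assumes "group G" "finite (carrier G)" "group H" "injective_on_commutators G H f"
  shows "orientation_preserving (complex_X G) (complex_X H) (map_X G f)"
proof -
  have nd: "nondegenerate_map (complex_X G) (complex_X H) (map_X G f)"
    using map_X_nondegenerate assms by blast
  have "map_X G f ` \<sigma> \<in> two_simplices (complex_X H)" if "\<sigma> \<in> two_simplices (complex_X G)" for \<sigma>
    using nd that
    by (auto simp: nondegenerate_map_def simplicial_map_def two_simplices_def card_image)
  moreover have "(map_X G f a, map_X G f b, map_X G f c) \<in> positive (complex_X H)"
    if p: "(a, b, c) \<in> positive (complex_X G)" for a b c
  proof -
    have hom: "f (x \<otimes>\<^bsub>G\<^esub> y) = f x \<otimes>\<^bsub>H\<^esub> f y" if "(x, y) \<in> noncommuting G" for x y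
      using assms(4) that by (auto simp: injective_on_commutators_def noncommuting_def hom_def)
    have "orients_two_simplices (complex_X G)"
      using finite_oriented_2_complex_X[OF assms(1,2)] by (simp add: finite_oriented_2_complex_def)
    from positive_vertices[OF this p]
    have "map_X G f v = (f (fst v), snd v)" if "v \<in> {a, b, c}" for v
      using that by (auto simp: map_X_def split: prod.split)
    note map_v = this
    obtain x y where xy: "(x, y) \<in> noncommuting G"
      and abc: "(a, b, c) \<in> {((x, 1), (y, 1), (x \<otimes>\<^bsub>G\<^esub> y, 2)),
        ((y, 1), (x \<otimes>\<^bsub>G\<^esub> y, 2), (x, 1)), ((x \<otimes>\<^bsub>G\<^esub> y, 2), (x, 1), (y, 1))}"
      using p by (auto simp: complex_X_def)
    show ?thesis
      using abc map_v[of a] map_v[of b] map_v[of c] hom[OF xy]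
        noncommuting_image[OF assms(1,3,4) xy]
      by (auto simp: complex_X_positive_iff simp del: One_nat_def)
  qed
  ultimately show ?thesis by (auto simp: orientation_preserving_def)
qed

lemma map_X_identity:
  "group G \<Longrightarrow> map_X G (\<lambda>x\<in>carrier G. x) = (\<lambda>v\<in>vertices (complex_X G). v)"
  by (auto simp: map_X_def vertices_complex_X fun_eq_iff)

lemma map_X_compose:
  assumes "group G" "group H" "injective_on_commutators G H f"
  shows "map_X G (compose (carrier G) g f) =
    compose (vertices (complex_X G)) (map_X H g) (map_X G f)"
proof (rule extensionalityI)
  fix v assume v: "v \<in> vertices (complex_X G)"
  \<comment> \<open>The second map is \<open>undefined\<close> on central elements, so the
    intermediate vertex must be noncentral in \<open>H\<close>; this uses preservation of
    noncommuting pairs.\<close>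
  have "map_X G f v \<in> vertices (complex_X H)"
    using simplicial_map_vertices map_X_nondegenerate[OF assms] v
    by (fastforce simp: nondegenerate_map_def)
  moreover have "fst v \<in> carrier G" using v by (auto simp: vertices_complex_X[OF assms(1)])
  ultimately show "map_X G (compose (carrier G) g f) v =
      compose (vertices (complex_X G)) (map_X H g) (map_X G f) v"
    using v by (auto simp: map_X_def compose_def split: prod.splits)
qed (simp_all add: map_X_def compose_extensional)

lemma map_Y_eq:
  "map_Y G H f = desingularization_map (complex_X G) (complex_X H) (map_X G f)"
  by (simp add: map_Y_def desingularization_map_def complex_Y_def)

theorem proposition2p26:
  shows "covariant_functor
    (category_C :: ('a monoid, 'a \<Rightarrow> 'a) category_data)
    (category_D :: ('a Y_vertex oriented_complex, 'a Y_vertex \<Rightarrow> 'a Y_vertex) category_data)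
    complex_Y map_Y"
proof -
  have X: "finite_oriented_2_complex (complex_X A)" "finite_simplicial_complex (simplices (complex_X A))"
    if "A \<in> Obj category_C" for A :: "'a monoid"
    using that finite_oriented_2_complex_X[of A]
    by (auto simp: category_C_def finite_oriented_2_complex_def)
  show ?thesis
  proof (intro covariant_functor.intro is_category_C is_category_D covariant_functor_axioms.intro)
    fix A :: "'a monoid" assume A: "A \<in> Obj category_C"
    show "complex_Y A \<in> Obj category_D"
      using finite_oriented_2_complex_desingularization[OF X(1)[OF A]]
      by (simp add: category_D_def complex_Y_def)
    show "map_Y A A (Ident category_C A) = Ident category_D (complex_Y A)"
      using A desingularization_map_identity[OF X(2)[OF A]]
      by (simp add: map_Y_eq category_C_def category_D_def complex_Y_def map_X_identity)
  next
    fix A B :: "'a monoid" and f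
    assume A: "A \<in> Obj category_C" and B: "B \<in> Obj category_C" and f: "f \<in> Mor category_C A B"
    have nd: "nondegenerate_map (complex_X A) (complex_X B) (map_X A f)"
      and op: "orientation_preserving (complex_X A) (complex_X B) (map_X A f)"
      using A B f map_X_nondegenerate[of A B f] map_X_orientation_preserving[of A B f]
      by (auto simp: category_C_def)
    have "map_Y A B f \<in> extensional (vertices (complex_Y A))"
      by (simp add: map_Y_def)
    then show "map_Y A B f \<in> Mor category_D (complex_Y A) (complex_Y B)"
      using desingularization_map_morphism[OF X(1)[OF A] nd op]
      by (simp add: category_D_def complex_Y_def map_Y_eq)
  next
    fix A B E :: "'a monoid" and f g
    assume A: "A \<in> Obj category_C" and B: "B \<in> Obj category_C" and E: "E \<in> Obj category_C"
      and f: "f \<in> Mor category_C A B" and g: "g \<in> Mor category_C B E"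
    have f': "nondegenerate_map (complex_X A) (complex_X B) (map_X A f)"
      and g': "nondegenerate_map (complex_X B) (complex_X E) (map_X B g)"
      using A B E f g map_X_nondegenerate[of A B f] map_X_nondegenerate[of B E g]
      by (auto simp: category_C_def)
    \<comment> \<open>Composition is respected in two stages, by X and then by
      desingularization.\<close>
    have "map_X A (Comp category_C A B E g f) =
        compose (vertices (complex_X A)) (map_X B g) (map_X A f)"
      using A B f map_X_compose[of A B f g] by (simp add: category_C_def)
    then show "map_Y A E (Comp category_C A B E g f) = Comp category_D (complex_Y A) (complex_Y B)
        (complex_Y E) (map_Y B E g) (map_Y A B f)"
      using desingularization_map_compose[OF X(2)[OF A] X(2)[OF B] f' g']
      by (simp add: map_Y_eq category_D_def complex_Y_def)
  qed
qed

end
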